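(* Let $p,q$ be distinct primes. The Laplacian spectrum of the cozero-divisor graph $\Gamma'(\mathbb{Z}_{pq}[x]/(x^2))$ is \[ \Big\{\big(pq(p-1)\big)^{[q(p-1)(q-1)-1]},\ \big(pq(q-1)\big)^{[p(p-1)(q-1)-1]}\Big\}, \] and the remaining $7$ eigenvalues are the eigenvalues of the matrix \[ \begin{pmatrix} p^2 - 1 & -(p-1) & 0 & 0 & -p(p-1) & 0 & 0 \\ -(q-1) & q^2 - 1 & 0 & -q(q-1) & 0 & 0 & 0 \\ 0 & 0 & q(q-1) + p(p-1) & -q(q-1) & -p(p-1) & 0 & 0 \\ 0 & -(p-1) & -(p-1)(q-1) & q(p^2 - 1) & -p(p-1) & 0 & -p(p-1)(q-1) \\ -(q-1) & 0 & -(p-1)(q-1) & -q(q-1) & p(q^2 - 1) & -q(p-1)(q-1) & 0 \\ 0 & 0 & 0 & 0 & -p(p-1) & p q (p-1) & -p(p-1)(q-1) \\ 0 & 0 & 0 & -q(q-1) & 0 & -q(p-1)(q-1) & p q (q-1) \end{pmatrix}. \]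
   Context: For a commutative ring $R$ with nonzero identity, the cozero-divisor graph $\Gamma'(R)$ is the simple undirected graph whose vertices are the nonzero non-unit elements of $R$, with two distinct vertices $u,v$ adjacent if and only if $u\notin Rv$ and $v\notin Ru$. $\mathbb{Z}_n$ denotes the ring of integers modulo $n$. The Laplacian matrix of a finite simple graph is $L=D-A$, where $D$ is the diagonal degree matrix and $A$ the adjacency matrix; the Laplacian spectrum is the multiset of eigenvalues of $L$ counted with multiplicity. The notation $\lambda^{[\mu]}$ means the eigenvalue $\lambda$ with multiplicity $\mu$.
   Formalization: The displayed spectrum is incomplete (23 vertices but 15 eigenvalues for p=2, q=3); the theorem proved adds p²−1 [q−2], q²−1 [p−2], q(q−1)+p(p−1) [(p−1)(q−1)−1], q(p²−1) [q(q−1)−1] and p(q²−1) [p(p−1)−1]. *)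

theory Defs
  imports
    "HOL-Number_Theory.Residues"
    "HOL-Algebra.UnivPoly"
    "HOL-Algebra.QuotRing"
    "Jordan_Normal_Form.Char_Poly"
begin

text \<open>
  For a commutative ring \<open>R\<close> the ideal \<open>Rv\<close> is \<open>PIdl\<^bsub>R\<^esub> v = {r \<otimes>\<^bsub>R\<^esub> v | r. r \<in> carrier R}\<close>.
\<close>

definition cozero_vertices :: "('a, 'm) ring_scheme \<Rightarrow> 'a set" where
  "cozero_vertices R = carrier R - Units R - {\<zero>\<^bsub>R\<^esub>}"

definition cozero_adj :: "('a, 'm) ring_scheme \<Rightarrow> 'a \<Rightarrow> 'a \<Rightarrow> bool" where
  "cozero_adj R u v \<longleftrightarrow>
     u \<in> cozero_vertices R \<and> v \<in> cozero_vertices R \<and> u \<noteq> v \<and>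
     u \<notin> PIdl\<^bsub>R\<^esub> v \<and> v \<notin> PIdl\<^bsub>R\<^esub> u"

definition dual_numbers_mod :: "nat \<Rightarrow> (nat \<Rightarrow> int) set ring" where
  "dual_numbers_mod n =
     (let Z = residue_ring (int n); P = UP Z
      in P Quot (PIdl\<^bsub>P\<^esub> (up_ring.monom P \<one>\<^bsub>Z\<^esub> 2)))"

text \<open>
  The matrices of a finite simple graph are taken with respect to an enumeration \<open>vs\<close> of its
  vertex set (a list without repetitions). They are complex matrices, so that the roots of a
  characteristic polynomial are all the eigenvalues.
\<close>

definition adjacency_matrix :: "'v list \<Rightarrow> ('v \<Rightarrow> 'v \<Rightarrow> bool) \<Rightarrow> complex mat" where
  "adjacency_matrix vs adj =
     mat (length vs) (length vs) (\<lambda>(i, j). if adj (vs ! i) (vs ! j) then 1 else 0)"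

definition degree_matrix :: "'v list \<Rightarrow> ('v \<Rightarrow> 'v \<Rightarrow> bool) \<Rightarrow> complex mat" where
  "degree_matrix vs adj =
     mat (length vs) (length vs)
       (\<lambda>(i, j). if i = j then of_nat (card {v \<in> set vs. adj (vs ! i) v}) else 0)"

definition laplacian_matrix :: "'v list \<Rightarrow> ('v \<Rightarrow> 'v \<Rightarrow> bool) \<Rightarrow> complex mat" where
  "laplacian_matrix vs adj = degree_matrix vs adj - adjacency_matrix vs adj"

definition eigenvalue_mset :: "complex mat \<Rightarrow> complex multiset" where
  "eigenvalue_mset A = proots (char_poly A)"

text \<open>
  The spectrum does not depend on the enumeration of the vertices; finiteness of the vertex set
  guarantees that an enumeration exists.
\<close>

definition has_laplacian_spectrum ::
    "'v set \<Rightarrow> ('v \<Rightarrow> 'v \<Rightarrow> bool) \<Rightarrow> complex multiset \<Rightarrow> bool" where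
  "has_laplacian_spectrum V adj S \<longleftrightarrow>
     finite V \<and>
     (\<forall>vs. distinct vs \<and> set vs = V \<longrightarrow> eigenvalue_mset (laplacian_matrix vs adj) = S)"

text \<open>
  By the decomposition of the ring as \<open>\<int>\<^sub>p[x]/(x\<^sup>2) \<times> \<int>\<^sub>q[x]/(x\<^sup>2)\<close>, each vertex has in each
  factor a component that is \<open>0\<close>, a nonzero nilpotent \<open>m\<close>, or a unit \<open>u\<close>. The rows and columns
  belong to the seven classes of associate vertices
  \<open>(0,m), (m,0), (m,m), (0,u), (u,0), (m,u), (u,m)\<close>, in this order.
\<close>

definition class_matrix :: "complex \<Rightarrow> complex \<Rightarrow> complex mat" where
  "class_matrix p q = mat_of_rows_list 7
    [[p^2 - 1, -(p-1), 0, 0, -p*(p-1), 0, 0],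
     [-(q-1), q^2 - 1, 0, -q*(q-1), 0, 0, 0],
     [0, 0, q*(q-1) + p*(p-1), -q*(q-1), -p*(p-1), 0, 0],
     [0, -(p-1), -(p-1)*(q-1), q*(p^2 - 1), -p*(p-1), 0, -p*(p-1)*(q-1)],
     [-(q-1), 0, -(p-1)*(q-1), -q*(q-1), p*(q^2 - 1), -q*(p-1)*(q-1), 0],
     [0, 0, 0, 0, -p*(p-1), p*q*(p-1), -p*(p-1)*(q-1)],
     [0, 0, 0, -q*(q-1), 0, -q*(p-1)*(q-1), p*q*(q-1)]]"

end

(*
  Associate vertices have the same neighbours, so adjacency only depends on the level of a vertex in
  each factor of Z_p[x]/(x^2) x Z_q[x]/(x^2), and there are seven pairs of levels. Write P for the
  vertex-by-class incidence matrix, D and E for the diagonal matrices of the x - degree over vertices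
  and over classes, and B for the adjacency of the classes. As D P = P E, factoring a single block
  matrix in two ways gives
    det (D + P B P^T) * det E = det D * det (E + B P^T P),
  where the first determinant is the characteristic polynomial of the Laplacian and the last one that
  of the class matrix. Hence a class of size n and degree d contributes the eigenvalue d with
  multiplicity n - 1, and the class matrix contributes the rest.
*)
theory Submission
  imports Defs "HOL-Algebra.Chinese_Remainder"
begin

section \<open>The Laplacian of a graph blown up from finitely many classes\<close>

text \<open>The relation \<open>D * P = P * E\<close> takes the place of an inverse of
  \<open>D\<close>, so the identity holds over a mere integral domain. This matters because the
  entries will be polynomials.\<close>

lemma det_rank_update:
  fixes D :: "'a :: idom mat"
  assumes D: "D \<in> carrier_mat n n" and E: "E \<in> carrier_mat k k"
    and P: "P \<in> carrier_mat n k" and Q: "Q \<in> carrier_mat k n"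
    and DP: "D * P = P * E"
  shows "det (D + P * Q) * det E = det D * det (E + Q * P)"
proof -
  let ?S = "four_block_mat D (- P) Q (1\<^sub>m k)"
  \<comment> \<open>First factorisation: both factors are block triangular with identity blocks
    apart from \<open>D + P * Q\<close>, so \<open>det ?S\<close> is the determinant of that
    block.\<close>
  have "four_block_mat (D + P * Q) (- P) (0\<^sub>m k n) (1\<^sub>m k) * four_block_mat (1\<^sub>m n) (0\<^sub>m n k) Q (1\<^sub>m k)
      = ?S"
  proof -
    have "D + P * Q + - P * Q = D"
      using D P Q by (intro eq_matI) auto
    then show ?thesis
      using D P Q by (subst mult_four_block_mat[of _ n n _ k _ k _ _ n _ k]) auto
  qed
  then have "det ?S = det (four_block_mat (D + P * Q) (- P) (0\<^sub>m k n) (1\<^sub>m k)) *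
      det (four_block_mat (1\<^sub>m n) (0\<^sub>m n k) Q (1\<^sub>m k))"
    using D P Q by (subst det_mult[of _ "n + k", symmetric]) auto
  then have 1: "det ?S = det (D + P * Q)"
    using D P Q by (simp add: det_four_block_mat_lower_left_zero[of _ n _ k]
        det_four_block_mat_upper_right_zero[of _ n _ k])
  \<comment> \<open>Second factorisation: the new upper right block is
    \<open>D * P - P * E = 0\<close>, and the right factor has determinant
    \<open>det E\<close>.\<close>
  have "?S * four_block_mat (1\<^sub>m n) P (0\<^sub>m k n) E
      = four_block_mat D (0\<^sub>m n k) Q (E + Q * P)"
  proof -
    have "D * P + - P * E = 0\<^sub>m n k"
      using D P E unfolding DP by (intro eq_matI) auto
    moreover have "Q * P + E = E + Q * P"
      using Q P E by (intro comm_add_mat) auto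
    ultimately show ?thesis
      using D P Q E by (subst mult_four_block_mat[of _ n n _ k _ k _ _ n _ k]) auto
  qed
  then have "det ?S * det (four_block_mat (1\<^sub>m n) P (0\<^sub>m k n) E)
      = det (four_block_mat D (0\<^sub>m n k) Q (E + Q * P))"
    using D P Q E by (subst det_mult[of _ "n + k", symmetric]) auto
  then show ?thesis
    using D P Q E by (simp add: 1 det_four_block_mat_lower_left_zero[of _ n _ k]
        det_four_block_mat_upper_right_zero[of _ n _ k])
qed

lemma det_diagonal:
  "det (mat n n (\<lambda>(i, j). if i = j then f i else 0)) = (\<Prod>i<n. f i :: 'a :: comm_ring_1)"
  by (subst det_upper_triangular[of _ n]) (auto simp: diag_mat_def prod.list_conv_set_nth intro!: prod.cong)

lemma sum_nth_distinct:
  "distinct xs \<Longrightarrow> (\<Sum>i<length xs. f (xs ! i)) = sum f (set xs)"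
  by (rule sum.reindex_bij_betw[OF bij_betw_nth]) auto

lemma prod_nth_distinct:
  "distinct xs \<Longrightarrow> (\<Prod>i<length xs. f (xs ! i)) = prod f (set xs)"
  by (rule prod.reindex_bij_betw[OF bij_betw_nth]) auto

lemma prod_over_fibres:
  assumes "finite V"
  shows "(\<Prod>v\<in>V. f (c v)) = (\<Prod>a\<in>c ` V. f a ^ card {v \<in> V. c v = a})"
proof -
  have "(\<Prod>v\<in>V. f (c v)) = (\<Prod>a\<in>c ` V. \<Prod>v\<in>{v \<in> V. c v = a}. f (c v))"
    using assms by (intro prod.group[symmetric]) auto
  also have "\<dots> = (\<Prod>a\<in>c ` V. f a ^ card {v \<in> V. c v = a})"
    by (intro prod.cong) auto
  finally show ?thesis .
qed

text \<open>All vertices of class \<open>a\<close> have the same degree \<open>d a\<close>, the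
  total size of the classes related to \<open>a\<close>. The characteristic matrix is therefore
  diagonal up to a product through the classes, and \<open>det_rank_update\<close> relates its
  determinant to that of a matrix indexed by classes.\<close>

lemma eigenvalue_mset_laplacian_classes:
  fixes vs :: "'v list" and ks :: "'c list" and c :: "'v \<Rightarrow> 'c" and N :: "'c \<Rightarrow> 'c \<Rightarrow> bool"
  assumes vs: "distinct vs" and ks: "distinct ks" and c: "c ` set vs = set ks"
    and adj: "\<And>u v. u \<in> set vs \<Longrightarrow> v \<in> set vs \<Longrightarrow> adj u v \<longleftrightarrow> N (c u) (c v)"
  defines "n \<equiv> \<lambda>a. card {v \<in> set vs. c v = a}"
  defines "d \<equiv> \<lambda>a. \<Sum>b\<in>set ks. if N a b then n b else 0"
  shows "eigenvalue_mset (laplacian_matrix vs adj) =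
    (\<Sum>a\<in>set ks. replicate_mset (n a - 1) (of_nat (d a))) +
    eigenvalue_mset (mat (length ks) (length ks) (\<lambda>(i, j).
      (if i = j then of_nat (d (ks ! i)) else 0) -
      (if N (ks ! i) (ks ! j) then of_nat (n (ks ! j)) else 0)))"
proof -
  define l where "l = length vs"
  define k where "k = length ks"
  define x where "x = (\<lambda>a. [:- of_nat (d a), 1:] :: complex poly)"
  define M :: "complex mat" where "M = mat k k (\<lambda>(i, j).
      (if i = j then of_nat (d (ks ! i)) else 0) -
      (if N (ks ! i) (ks ! j) then of_nat (n (ks ! j)) else 0))"
  let ?L = "laplacian_matrix vs adj"
  define D where "D = mat l l (\<lambda>(i, j). if i = j then x (c (vs ! i)) else 0)"
  define E where "E = mat k k (\<lambda>(i, j). if i = j then x (ks ! i) else 0)"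
  \<comment> \<open>\<open>P\<close> is the vertex-by-class incidence matrix; \<open>Q\<close>
    already includes the relation \<open>N\<close> between classes, so that \<open>P * Q\<close> is
    the adjacency matrix.\<close>
  define P where "P = mat l k (\<lambda>(i, a). if c (vs ! i) = ks ! a then 1 else (0 :: complex poly))"
  define Q where "Q = mat k l (\<lambda>(a, j). if N (ks ! a) (c (vs ! j)) then 1 else (0 :: complex poly))"
  have carrier: "D \<in> carrier_mat l l" "E \<in> carrier_mat k k" "P \<in> carrier_mat l k" "Q \<in> carrier_mat k l"
    by (auto simp: D_def E_def P_def Q_def)
  have c_in: "c (vs ! i) \<in> set ks" if "i < l" for i
    using c that by (auto simp: l_def)
  have deg: "card {v \<in> set vs. adj u v} = d (c u)" if u: "u \<in> set vs" for u
  proof -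
    have "{v \<in> set vs. adj u v} = (\<Union>b\<in>{b \<in> set ks. N (c u) b}. {v \<in> set vs. c v = b})"
      using adj[OF u] c by auto
    also have "card \<dots> = (\<Sum>b\<in>{b \<in> set ks. N (c u) b}. n b)"
      unfolding n_def by (rule card_UN_disjoint) auto
    also have "\<dots> = d (c u)"
      unfolding d_def by (simp add: sum.If_cases Int_def)
    finally show ?thesis .
  qed
  have DP: "D * P = P * E"
  proof (rule eq_matI)
    fix i a assume "i < dim_row (P * E)" "a < dim_col (P * E)"
    then have i: "i < l" and a: "a < k" using carrier by auto
    have "(D * P) $$ (i, a) = (\<Sum>j\<in>{0..<l}. D $$ (i, j) * P $$ (j, a))"
      using i a carrier by (auto simp: scalar_prod_def)
    also have "\<dots> = (\<Sum>j\<in>{0..<l}. if j = i then x (c (vs ! i)) * P $$ (i, a) else 0)"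
      using i by (intro sum.cong) (auto simp: D_def)
    also have "\<dots> = x (c (vs ! i)) * P $$ (i, a)"
      using i by simp
    also have "\<dots> = P $$ (i, a) * x (ks ! a)"
      using i a by (simp add: P_def)
    also have "\<dots> = (\<Sum>j\<in>{0..<k}. if j = a then P $$ (i, a) * x (ks ! a) else 0)"
      using a by simp
    also have "\<dots> = (\<Sum>j\<in>{0..<k}. P $$ (i, j) * E $$ (j, a))"
      using a by (intro sum.cong) (auto simp: E_def)
    also have "\<dots> = (P * E) $$ (i, a)"
      using i a carrier by (auto simp: scalar_prod_def)
    finally show "(D * P) $$ (i, a) = (P * E) $$ (i, a)" .
  qed (use carrier in auto)
  \<comment> \<open>Since \<open>X - (degree - adjacency) = (X - degree) + adjacency\<close>, the
    adjacency matrix enters with a plus sign.\<close>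
  have L: "char_poly_matrix ?L = D + P * Q"
  proof (rule eq_matI)
    fix i j assume "i < dim_row (D + P * Q)" "j < dim_col (D + P * Q)"
    then have i: "i < l" and j: "j < l" using carrier by auto
    have "(P * Q) $$ (i, j) = (\<Sum>a<k. (if c (vs ! i) = ks ! a then 1 else 0) *
        (if N (ks ! a) (c (vs ! j)) then 1 else 0))"
      using i j carrier by (simp add: scalar_prod_def P_def Q_def atLeast0LessThan)
    also have "\<dots> = (\<Sum>a\<in>set ks. (if c (vs ! i) = a then 1 else 0) *
        (if N a (c (vs ! j)) then 1 else 0))"
      unfolding k_def by (rule sum_nth_distinct[OF ks])
    also have "\<dots> = (\<Sum>a\<in>set ks. if c (vs ! i) = a then
        (if N (c (vs ! i)) (c (vs ! j)) then 1 else 0) else 0)"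
      by (intro sum.cong) auto
    also have "\<dots> = (if N (c (vs ! i)) (c (vs ! j)) then 1 else 0)"
      using c_in[OF i] by simp
    also have "N (c (vs ! i)) (c (vs ! j)) = adj (vs ! i) (vs ! j)"
      using adj i j by (simp add: l_def)
    finally have PQ: "(P * Q) $$ (i, j) = (if adj (vs ! i) (vs ! j) then 1 else 0)" .
    show "char_poly_matrix ?L $$ (i, j) = (D + P * Q) $$ (i, j)"
      using i j carrier PQ
      by (auto simp: char_poly_matrix_def laplacian_matrix_def degree_matrix_def
          adjacency_matrix_def D_def x_def deg l_def one_pCons)
  qed (use carrier in \<open>auto simp: char_poly_matrix_def laplacian_matrix_def degree_matrix_def
          adjacency_matrix_def l_def\<close>)
  \<comment> \<open>Multiplying in the other order counts vertices: entry \<open>(a, b)\<close> of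
    \<open>Q * P\<close> is the size of class \<open>b\<close> if the two classes are
    related.\<close>
  have M: "char_poly_matrix M = E + Q * P"
  proof (rule eq_matI)
    fix a b assume "a < dim_row (E + Q * P)" "b < dim_col (E + Q * P)"
    then have a: "a < k" and b: "b < k" using carrier by auto
    have "(Q * P) $$ (a, b) = (\<Sum>j<l. (if N (ks ! a) (c (vs ! j)) then 1 else 0) *
        (if c (vs ! j) = ks ! b then 1 else 0))"
      using a b carrier by (simp add: scalar_prod_def P_def Q_def atLeast0LessThan)
    also have "\<dots> = (\<Sum>v\<in>set vs. (if N (ks ! a) (c v) then 1 else 0) *
        (if c v = ks ! b then 1 else 0))"
      unfolding l_def by (rule sum_nth_distinct[OF vs])
    also have "\<dots> = (\<Sum>v\<in>set vs. if c v = ks ! b then (if N (ks ! a) (ks ! b) then 1 else 0) else 0)"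
      by (intro sum.cong) auto
    also have "\<dots> = (if N (ks ! a) (ks ! b) then of_nat (n (ks ! b)) else 0)"
      by (simp add: sum.If_cases Int_def n_def)
    finally have QP: "(Q * P) $$ (a, b) = (if N (ks ! a) (ks ! b) then of_nat (n (ks ! b)) else 0)" .
    show "char_poly_matrix M $$ (a, b) = (E + Q * P) $$ (a, b)"
      using a b carrier QP
      by (auto simp: char_poly_matrix_def M_def E_def x_def of_nat_poly)
  qed (use carrier in \<open>auto simp: char_poly_matrix_def M_def\<close>)
  have det_D: "det D = (\<Prod>a\<in>set ks. x a ^ n a)"
  proof -
    have "det D = (\<Prod>i<l. x (c (vs ! i)))"
      unfolding D_def by (rule det_diagonal)
    also have "\<dots> = (\<Prod>v\<in>set vs. x (c v))"
      unfolding l_def by (rule prod_nth_distinct[OF vs])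
    also have "\<dots> = (\<Prod>a\<in>set ks. x a ^ n a)"
      unfolding n_def c[symmetric] by (rule prod_over_fibres) auto
    finally show ?thesis .
  qed
  have det_E: "det E = (\<Prod>a\<in>set ks. x a)"
  proof -
    have "det E = (\<Prod>i<k. x (ks ! i))"
      unfolding E_def by (rule det_diagonal)
    then show ?thesis
      unfolding k_def by (simp add: prod_nth_distinct[OF ks])
  qed
  \<comment> \<open>Every class is nonempty, so the subtraction in \<open>n a - 1\<close> is not
    truncated.\<close>
  have n_pos: "n a = Suc (n a - 1)" if "a \<in> set ks" for a
  proof -
    from that obtain v where "v \<in> set vs" "c v = a" unfolding c[symmetric] by auto
    then have "0 < n a" unfolding n_def by (subst card_gt_0_iff) auto
    then show ?thesis by simp
  qed
  have x_nz: "x a \<noteq> 0" for a by (simp add: x_def)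
  have "char_poly ?L * (\<Prod>a\<in>set ks. x a) = (\<Prod>a\<in>set ks. x a ^ n a) * char_poly M"
    using det_rank_update[OF carrier DP] by (simp add: char_poly_def L M det_D det_E)
  \<comment> \<open>One linear factor per class is split off, to be cancelled against
    \<open>det E\<close> on the other side.\<close>
  also have "(\<Prod>a\<in>set ks. x a ^ n a) = (\<Prod>a\<in>set ks. x a ^ (n a - 1)) * (\<Prod>a\<in>set ks. x a)"
    unfolding prod.distrib[symmetric] using n_pos
    by (intro prod.cong) (auto simp: power_Suc2 simp flip: power_Suc2)
  finally have "char_poly ?L = (\<Prod>a\<in>set ks. x a ^ (n a - 1)) * char_poly M"
    using x_nz by (simp add: mult.assoc mult.commute[of "char_poly M"] mult.left_commute)
  \<comment> \<open>Root multisets add up over a product only if the factors are nonzero; a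
    characteristic polynomial is monic.\<close>
  moreover have "char_poly M \<noteq> 0"
    using degree_monic_char_poly[of M k] by (auto simp: M_def)
  ultimately have "proots (char_poly ?L) =
      (\<Sum>a\<in>set ks. repeat_mset (n a - 1) (proots (x a))) + proots (char_poly M)"
    using x_nz by (simp add: proots_mult proots_prod proots_power)
  then show ?thesis
    by (simp add: eigenvalue_mset_def M_def k_def x_def)
qed

section \<open>Dual numbers\<close>

text \<open>The pair \<open>(a, b)\<close> stands for \<open>a + b x\<close> with
  \<open>x^2 = 0\<close>. This concrete model replaces cosets of polynomials by
  coefficients.\<close>

definition dual_ring :: "('a, 'm) ring_scheme \<Rightarrow> ('a \<times> 'a) ring" where
  "dual_ring R =
    \<lparr>carrier = carrier R \<times> carrier R,
     monoid.mult = (\<lambda>(a, b) (a', b'). (a \<otimes>\<^bsub>R\<^esub> a', a \<otimes>\<^bsub>R\<^esub> b' \<oplus>\<^bsub>R\<^esub> b \<otimes>\<^bsub>R\<^esub> a')),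
     one = (\<one>\<^bsub>R\<^esub>, \<zero>\<^bsub>R\<^esub>),
     zero = (\<zero>\<^bsub>R\<^esub>, \<zero>\<^bsub>R\<^esub>),
     add = (\<lambda>(a, b) (a', b'). (a \<oplus>\<^bsub>R\<^esub> a', b \<oplus>\<^bsub>R\<^esub> b'))\<rparr>"

lemma dual_ring_simps [simp]:
  "carrier (dual_ring R) = carrier R \<times> carrier R"
  "(a, b) \<otimes>\<^bsub>dual_ring R\<^esub> (a', b') = (a \<otimes>\<^bsub>R\<^esub> a', a \<otimes>\<^bsub>R\<^esub> b' \<oplus>\<^bsub>R\<^esub> b \<otimes>\<^bsub>R\<^esub> a')"
  "\<one>\<^bsub>dual_ring R\<^esub> = (\<one>\<^bsub>R\<^esub>, \<zero>\<^bsub>R\<^esub>)"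
  "\<zero>\<^bsub>dual_ring R\<^esub> = (\<zero>\<^bsub>R\<^esub>, \<zero>\<^bsub>R\<^esub>)"
  "(a, b) \<oplus>\<^bsub>dual_ring R\<^esub> (a', b') = (a \<oplus>\<^bsub>R\<^esub> a', b \<oplus>\<^bsub>R\<^esub> b')"
  by (simp_all add: dual_ring_def)

lemma (in cring) dual_ring_cring: "cring (dual_ring R)"
proof (rule cringI)
  show "abelian_group (dual_ring R)"
  proof (rule abelian_groupI)
    fix x assume "x \<in> carrier (dual_ring R)"
    then obtain a b where "x = (a, b)" "a \<in> carrier R" "b \<in> carrier R" by auto
    then show "\<exists>y\<in>carrier (dual_ring R). y \<oplus>\<^bsub>dual_ring R\<^esub> x = \<zero>\<^bsub>dual_ring R\<^esub>"
      by (intro bexI[of _ "(\<ominus> a, \<ominus> b)"]) (auto simp: l_neg)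
  qed (auto simp: a_ac)
  show "comm_monoid (dual_ring R)"
  proof (rule comm_monoidI)
    fix x y z
    assume "x \<in> carrier (dual_ring R)" "y \<in> carrier (dual_ring R)" "z \<in> carrier (dual_ring R)"
    then show "x \<otimes>\<^bsub>dual_ring R\<^esub> y \<otimes>\<^bsub>dual_ring R\<^esub> z = x \<otimes>\<^bsub>dual_ring R\<^esub> (y \<otimes>\<^bsub>dual_ring R\<^esub> z)"
      by (auto simp: m_assoc l_distr r_distr a_assoc)
  next
    fix x y
    assume "x \<in> carrier (dual_ring R)" "y \<in> carrier (dual_ring R)"
    then show "x \<otimes>\<^bsub>dual_ring R\<^esub> y = y \<otimes>\<^bsub>dual_ring R\<^esub> x"
      by (auto simp: m_comm a_comm)
  qed auto
  fix x y z
  assume "x \<in> carrier (dual_ring R)" "y \<in> carrier (dual_ring R)" "z \<in> carrier (dual_ring R)"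
  then show "(x \<oplus>\<^bsub>dual_ring R\<^esub> y) \<otimes>\<^bsub>dual_ring R\<^esub> z =
      x \<otimes>\<^bsub>dual_ring R\<^esub> z \<oplus>\<^bsub>dual_ring R\<^esub> y \<otimes>\<^bsub>dual_ring R\<^esub> z"
    by (auto simp: l_distr a_ac)
qed

context UP_cring
begin

lemma truncate_ring_hom:
  "ring_hom_ring P (dual_ring R) (\<lambda>f. (up_ring.coeff P f 0, up_ring.coeff P f 1))"
proof (intro ring_hom_ringI UP_ring cring.axioms(1)[OF R.dual_ring_cring])
  fix f g assume fg: "f \<in> carrier P" "g \<in> carrier P"
  \<comment> \<open>The convolution for the linear coefficient has just these two terms, the ones in
    the product of \<open>dual_ring\<close>.\<close>
  have "{..Suc 0} = {0, 1}" by auto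
  then show "(up_ring.coeff P (f \<otimes>\<^bsub>P\<^esub> g) 0, up_ring.coeff P (f \<otimes>\<^bsub>P\<^esub> g) 1) =
      (up_ring.coeff P f 0, up_ring.coeff P f 1) \<otimes>\<^bsub>dual_ring R\<^esub>
      (up_ring.coeff P g 0, up_ring.coeff P g 1)"
    using fg coeff_closed by (simp add: Pi_def)
qed (use coeff_closed in auto)

text \<open>A polynomial without constant and linear terms is divisible by \<open>x^2\<close>: the
  quotient is obtained by shifting its coefficients by two places.\<close>

lemma truncate_kernel:
  "a_kernel P (dual_ring R) (\<lambda>f. (up_ring.coeff P f 0, up_ring.coeff P f 1)) =
    PIdl\<^bsub>P\<^esub> (up_ring.monom P \<one> 2)"
proof -
  let ?m = "up_ring.monom P \<one> 2"
  \<comment> \<open>In the convolution the index of \<open>?m\<close> is at most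
    \<open>i < 2\<close>, where this monomial has coefficient zero.\<close>
  have low: "up_ring.coeff P (g \<otimes>\<^bsub>P\<^esub> ?m) i = \<zero>" if "g \<in> carrier P" "i < 2" for g i
  proof -
    have "up_ring.coeff P (g \<otimes>\<^bsub>P\<^esub> ?m) i =
        (\<Oplus>j\<in>{..i}. up_ring.coeff P g j \<otimes> up_ring.coeff P ?m (i - j))"
      using that by simp
    also have "\<dots> = (\<Oplus>j\<in>{..i}. \<zero>)"
      using that coeff_closed by (intro R.finsum_cong') auto
    finally show ?thesis by simp
  qed
  have high: "up_ring.coeff P (g \<otimes>\<^bsub>P\<^esub> ?m) (i + 2) = up_ring.coeff P g i" if "g \<in> carrier P" for g i
    using that coeff_monom_mult[of \<one> g 2 i] coeff_closed by (simp del: coeff_mult add: UP_m_comm)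
  have "\<exists>g\<in>carrier P. f = g \<otimes>\<^bsub>P\<^esub> ?m"
    if f: "f \<in> carrier P" "up_ring.coeff P f 0 = \<zero>" "up_ring.coeff P f 1 = \<zero>" for f
  proof -
    define g where "g = (\<lambda>i. up_ring.coeff P f (i + 2))"
    have up: "f \<in> up R"
      using f(1) by (simp add: P_def UP_def)
    then have coeff: "up_ring.coeff P f = f"
      by (simp add: P_def UP_def)
    from up obtain b where b: "bound \<zero> b f"
      using R.bound_upD by blast
    \<comment> \<open>Beyond \<open>b\<close> the shifted index is beyond \<open>b\<close> too, so
      the bound for \<open>f\<close> also serves for \<open>g\<close>.\<close>
    have "bound \<zero> b g"
      unfolding g_def coeff by (rule bound.intro) (rule bound.bound[OF b], simp)
    moreover have "g n \<in> carrier R" for n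
      using f(1) coeff_closed by (simp add: g_def)
    ultimately have "g \<in> up R"
      by (intro mem_upI exI)
    then have g: "g \<in> carrier P" "up_ring.coeff P g = g"
      by (simp_all add: P_def UP_def)
    have "f = g \<otimes>\<^bsub>P\<^esub> ?m"
    proof (rule up_eqI)
      fix i :: nat
      consider "i = 0" | "i = 1" | j where "i = j + 2"
        by (metis One_nat_def add_2_eq_Suc' not0_implies_Suc)
      then show "up_ring.coeff P f i = up_ring.coeff P (g \<otimes>\<^bsub>P\<^esub> ?m) i"
      proof cases
        case 3
        have "up_ring.coeff P f i = g j" by (simp add: g_def 3)
        then show ?thesis using high[OF g(1), of j] by (simp only: 3 g(2))
      next
        case 1
        then show ?thesis using f(2) low[OF g(1), of 0] by (simp only: 1)
      next
        case 2
        then show ?thesis using f(3) low[OF g(1), of 1] by (simp only: 2)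
      qed
    qed (use f g in auto)
    then show ?thesis using g by blast
  qed
  moreover have "g \<otimes>\<^bsub>P\<^esub> ?m \<in> carrier P" if "g \<in> carrier P" for g
    using that by simp
  ultimately show ?thesis
    using low by (auto simp: a_kernel_def' cgenideal_def simp del: coeff_mult)
qed

text \<open>First isomorphism theorem for truncation after the linear term; the polynomial
  \<open>a + b x\<close> is a preimage of \<open>(a, b)\<close>.\<close>

lemma quotient_dual_ring_iso:
  "P Quot (PIdl\<^bsub>P\<^esub> (up_ring.monom P \<one> 2)) \<simeq> dual_ring R"
proof -
  have "\<exists>f\<in>carrier P. up_ring.coeff P f 0 = a \<and> up_ring.coeff P f 1 = b"
    if "a \<in> carrier R" "b \<in> carrier R" for a b
    using that by (intro bexI[of _ "up_ring.monom P a 0 \<oplus>\<^bsub>P\<^esub> up_ring.monom P b 1"]) auto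
  then have "(\<lambda>f. (up_ring.coeff P f 0, up_ring.coeff P f 1)) ` carrier P = carrier (dual_ring R)"
    by (auto simp: image_iff Bex_def)
  then show ?thesis
    using ring_hom_ring.FactRing_iso[OF truncate_ring_hom] by (simp add: truncate_kernel del: One_nat_def)
qed

end

section \<open>Invariance of principal ideals and cozero vertices under ring isomorphisms\<close>

lemma iso_PIdl:
  assumes A: "cring A" and h: "h \<in> ring_iso A B" and u: "u \<in> carrier A" and v: "v \<in> carrier A"
  shows "h u \<in> PIdl\<^bsub>B\<^esub> (h v) \<longleftrightarrow> u \<in> PIdl\<^bsub>A\<^esub> v"
proof -
  interpret A: cring A by fact
  note iso = ring_iso_memE[OF h]
  have B: "carrier B = h ` carrier A"
    using iso(5) by (simp add: bij_betw_def)
  have "h u = h x \<otimes>\<^bsub>B\<^esub> h v \<longleftrightarrow> u = x \<otimes>\<^bsub>A\<^esub> v" if x: "x \<in> carrier A" for x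
  proof -
    have "h u = h x \<otimes>\<^bsub>B\<^esub> h v \<longleftrightarrow> h u = h (x \<otimes>\<^bsub>A\<^esub> v)"
      using iso(2)[OF x v] by simp
    also have "\<dots> \<longleftrightarrow> u = x \<otimes>\<^bsub>A\<^esub> v"
      using iso(5) u A.m_closed[OF x v] by (auto simp: bij_betw_def inj_on_def)
    finally show ?thesis .
  qed
  then show ?thesis
    by (auto simp: cgenideal_def B)
qed

text \<open>Expresses units through principal ideals, so that results on principal ideals also
  determine which elements are vertices.\<close>

lemma (in cring) Units_iff_one_in_PIdl:
  "u \<in> Units R \<longleftrightarrow> u \<in> carrier R \<and> \<one> \<in> PIdl u"
  by (auto simp: Units_def cgenideal_def) (metis m_comm)+

lemma iso_cozero_vertices:
  assumes A: "cring A" and B: "cring B" and h: "h \<in> ring_iso A B"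
  shows "bij_betw h (cozero_vertices A) (cozero_vertices B)"
proof -
  interpret A: cring A by fact
  interpret B: cring B by fact
  note iso = ring_iso_memE[OF h]
  \<comment> \<open>Membership in \<open>ring_iso\<close> asks for sums, products and one to be
    preserved; for zero the additive group structure of both rings is needed.\<close>
  have zero: "h \<zero>\<^bsub>A\<^esub> = \<zero>\<^bsub>B\<^esub>"
    using h ring_hom_zero[OF _ A.ring_axioms B.ring_axioms] by (simp add: ring_iso_def)
  have inj: "h u = h v \<longleftrightarrow> u = v" if "u \<in> carrier A" "v \<in> carrier A" for u v
    using iso(5) that by (auto simp: bij_betw_def inj_on_def)
  have "h u \<in> cozero_vertices B \<longleftrightarrow> u \<in> cozero_vertices A" if u: "u \<in> carrier A" for u
    using u iso(1)[OF u] iso_PIdl[OF A h A.one_closed u] inj[OF u A.zero_closed]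
    by (simp add: cozero_vertices_def A.Units_iff_one_in_PIdl B.Units_iff_one_in_PIdl zero iso(4))
  moreover have "cozero_vertices A \<subseteq> carrier A" "cozero_vertices B \<subseteq> h ` carrier A"
    using iso(5) by (auto simp: cozero_vertices_def bij_betw_def)
  ultimately have "h ` cozero_vertices A = cozero_vertices B"
    by (auto simp: subset_iff image_iff) metis
  then show ?thesis
    using iso(5) by (auto simp: bij_betw_def cozero_vertices_def intro: inj_on_subset)
qed

section \<open>Direct products of rings\<close>

lemma RDirProd_simps [simp]:
  "carrier (RDirProd R S) = carrier R \<times> carrier S"
  "(a, b) \<otimes>\<^bsub>RDirProd R S\<^esub> (a', b') = (a \<otimes>\<^bsub>R\<^esub> a', b \<otimes>\<^bsub>S\<^esub> b')"
  "\<one>\<^bsub>RDirProd R S\<^esub> = (\<one>\<^bsub>R\<^esub>, \<one>\<^bsub>S\<^esub>)"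
  "\<zero>\<^bsub>RDirProd R S\<^esub> = (\<zero>\<^bsub>R\<^esub>, \<zero>\<^bsub>S\<^esub>)"
  "(a, b) \<oplus>\<^bsub>RDirProd R S\<^esub> (a', b') = (a \<oplus>\<^bsub>R\<^esub> a', b \<oplus>\<^bsub>S\<^esub> b')"
  by (simp_all add: RDirProd_def DirProd_def monoid.defs)

lemma RDirProd_cring:
  assumes "cring R" "cring S"
  shows "cring (RDirProd R S)"
proof -
  interpret R: cring R by fact
  interpret S: cring S by fact
  interpret RS: ring "RDirProd R S"
    by (rule RDirProd_ring[OF R.ring_axioms S.ring_axioms])
  show ?thesis
    by unfold_locales (auto simp: R.m_comm S.m_comm)
qed

text \<open>A multiplier in the product is an independent choice of one multiplier in each
  factor.\<close>

lemma PIdl_RDirProd: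
  "PIdl\<^bsub>RDirProd R S\<^esub> (v, w) = (PIdl\<^bsub>R\<^esub> v) \<times> (PIdl\<^bsub>S\<^esub> w)"
  by (auto simp: cgenideal_def)

section \<open>Divisibility in the dual numbers over a field\<close>

text \<open>Over a field the levels 0, 1 and 2 number the ideals \<open>0\<close>,
  \<open>(x)\<close> and the whole ring in increasing order, according to which of them the element
  generates.\<close>

definition dual_level :: "('a, 'm) ring_scheme \<Rightarrow> 'a \<times> 'a \<Rightarrow> nat" where
  "dual_level R x = (if fst x \<noteq> \<zero>\<^bsub>R\<^esub> then 2 else if snd x \<noteq> \<zero>\<^bsub>R\<^esub> then 1 else 0)"

lemma dual_level_le: "dual_level R x \<le> 2"
  by (simp add: dual_level_def)

lemma dual_level_eq_0_iff: "dual_level R x = 0 \<longleftrightarrow> x = \<zero>\<^bsub>dual_ring R\<^esub>"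
  by (auto simp: dual_level_def prod_eq_iff)

text \<open>The principal ideals form a chain of three: an element with nonzero constant coefficient
  is a unit, a nonzero \<open>b x\<close> generates all multiples of \<open>x\<close>, and zero
  generates only itself.\<close>

lemma (in field) dual_ring_PIdl_iff:
  assumes u: "u \<in> carrier (dual_ring R)" and v: "v \<in> carrier (dual_ring R)"
  shows "u \<in> PIdl\<^bsub>dual_ring R\<^esub> v \<longleftrightarrow> dual_level R u \<le> dual_level R v"
proof -
  interpret D: cring "dual_ring R" by (rule dual_ring_cring)
  obtain c d where u': "u = (c, d)" "c \<in> carrier R" "d \<in> carrier R" using u by auto
  obtain a b where v': "v = (a, b)" "a \<in> carrier R" "b \<in> carrier R" using v by auto
  have inv: "inv x \<in> carrier R" "inv x \<otimes> x = \<one>" if "x \<in> carrier R" "x \<noteq> \<zero>" for x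
    using that field_Units by auto
  consider "a \<noteq> \<zero>" | "a = \<zero>" "b \<noteq> \<zero>" | "a = \<zero>" "b = \<zero>" by blast
  then show ?thesis
  proof cases
    case 1
    \<comment> \<open>The inverse of \<open>a + b x\<close> is
      \<open>1/a - (b/a^2) x\<close>.\<close>
    define y where "y = (inv a, \<ominus> (inv a \<otimes> inv a \<otimes> b))"
    have y: "y \<in> carrier (dual_ring R)" and yv: "y \<otimes>\<^bsub>dual_ring R\<^esub> v = \<one>\<^bsub>dual_ring R\<^esub>"
    proof -
      have "inv a \<otimes> inv a \<otimes> b \<otimes> a = inv a \<otimes> b \<otimes> (inv a \<otimes> a)"
        using v' inv(1)[OF _ 1] by (simp add: m_ac)
      then show "y \<in> carrier (dual_ring R)" "y \<otimes>\<^bsub>dual_ring R\<^esub> v = \<one>\<^bsub>dual_ring R\<^esub>"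
        using v' inv[OF _ 1] by (auto simp: y_def l_minus r_neg)
    qed
    have "u = (u \<otimes>\<^bsub>dual_ring R\<^esub> y) \<otimes>\<^bsub>dual_ring R\<^esub> v"
      using D.m_assoc[OF u y v] D.r_one[OF u] yv by simp
    then have "u \<in> PIdl\<^bsub>dual_ring R\<^esub> v"
      using D.m_closed[OF u y] unfolding cgenideal_def by (intro CollectI exI conjI)
    then show ?thesis
      using 1 by (simp add: dual_level_def v')
  next
    case 2
    \<comment> \<open>Here \<open>v = b x\<close>; if \<open>c\<close> vanishes then
      \<open>u = d x\<close>, which is \<open>d/b\<close> times \<open>v\<close>.\<close>
    have "d = d \<otimes> inv b \<otimes> b"
      using u' v' inv[OF _ 2(2)] by (simp add: m_assoc)
    then have "u = (d \<otimes> inv b, \<zero>) \<otimes>\<^bsub>dual_ring R\<^esub> v" if "c = \<zero>"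
      using that 2 u' v' inv[OF _ 2(2)] by simp
    moreover have "(d \<otimes> inv b, \<zero>) \<in> carrier (dual_ring R)"
      using u' v' inv[OF _ 2(2)] by simp
    ultimately have "u \<in> PIdl\<^bsub>dual_ring R\<^esub> v" if "c = \<zero>"
      using that unfolding cgenideal_def by blast
    moreover have "c = \<zero>" if "u \<in> PIdl\<^bsub>dual_ring R\<^esub> v"
      using that 2 u' v' by (auto simp: cgenideal_def)
    ultimately have "u \<in> PIdl\<^bsub>dual_ring R\<^esub> v \<longleftrightarrow> c = \<zero>"
      by blast
    then show ?thesis
      using 2 by (simp add: dual_level_def u' v')
  next
    case 3
    have "u = v" if "c = \<zero>" "d = \<zero>"
      using that 3 u' v' by simp
    then have "u \<in> PIdl\<^bsub>dual_ring R\<^esub> v" if "c = \<zero>" "d = \<zero>"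
      using that D.cgenideal_self[OF v] by simp
    moreover have "c = \<zero> \<and> d = \<zero>" if "u \<in> PIdl\<^bsub>dual_ring R\<^esub> v"
      using that 3 u' v' by (auto simp: cgenideal_def)
    ultimately have "u \<in> PIdl\<^bsub>dual_ring R\<^esub> v \<longleftrightarrow> c = \<zero> \<and> d = \<zero>"
      by blast
    then show ?thesis
      using 3 by (simp add: dual_level_def u' v')
  qed
qed

text \<open>Here \<open>m\<close> is the number of elements of the field. The last branch is meant
  for level 2: a nonzero constant coefficient and any coefficient of \<open>x\<close>.\<close>

definition level_count :: "nat \<Rightarrow> nat \<Rightarrow> nat" where
  "level_count m i = (if i = 0 then 1 else if i = 1 then m - 1 else m * (m - 1))"

lemma (in ring) card_dual_level:
  assumes fin: "finite (carrier R)" and i: "i \<le> 2"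
  shows "card {x \<in> carrier (dual_ring R). dual_level R x = i} = level_count (card (carrier R)) i"
proof -
  let ?C = "carrier R - {\<zero>}"
  have "{x \<in> carrier (dual_ring R). dual_level R x = i} =
      (if i = 0 then {(\<zero>, \<zero>)} else if i = 1 then {\<zero>} \<times> ?C else ?C \<times> carrier R)"
    using i by (auto simp: dual_level_def split: if_splits)
  then show ?thesis
    using fin by (simp add: level_count_def card_cartesian_product card_Diff_singleton)
qed

section \<open>Decomposition by the Chinese remainder theorem\<close>

text \<open>Both coefficients are reduced modulo \<open>p\<close> and modulo \<open>q\<close>.
  Injectivity is the uniqueness half of the Chinese remainder theorem, and surjectivity follows by
  counting.\<close>

lemma dual_residue_ring_iso:
  fixes p q :: int
  assumes p: "p > 1" and q: "q > 1" and pq: "coprime p q"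
  shows "dual_ring (residue_ring (p * q)) \<simeq>
    RDirProd (dual_ring (residue_ring p)) (dual_ring (residue_ring q))"
proof -
  let ?A = "dual_ring (residue_ring (p * q))"
  let ?B = "RDirProd (dual_ring (residue_ring p)) (dual_ring (residue_ring q))"
  let ?h = "\<lambda>(a, b). ((a mod p, b mod p), (a mod q, b mod q))"
  have carrier: "carrier (residue_ring m) = {0..m - 1}" for m
    by (simp add: residue_ring_def)
  have mod_eqD: "a = b"
    if "a mod p = b mod p" "a mod q = b mod q" "0 \<le> a" "a \<le> p * q - 1" "0 \<le> b" "b \<le> p * q - 1" for a b
  proof -
    have "[a = b] (mod p * q)"
      using that pq by (intro coprime_cong_mult) (auto simp: cong_def)
    then show ?thesis
      using that by (simp add: cong_def)
  qed
  have inj: "inj_on ?h (carrier ?A)"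
    using mod_eqD by (auto simp: inj_on_def carrier)
  have into: "?h ` carrier ?A \<subseteq> carrier ?B"
    using p q by (auto simp: carrier zle_diff1_eq)
  have "card (carrier ?A) = card (carrier ?B)"
    using p q by (simp add: carrier card_cartesian_product nat_mult_distrib mult_ac)
  then have "?h ` carrier ?A = carrier ?B"
    using inj into by (intro card_subset_eq) (auto simp: carrier card_image)
  then have bij: "bij_betw ?h (carrier ?A) (carrier ?B)"
    using inj by (simp add: bij_betw_def)
  \<comment> \<open>The operations in the source reduce modulo \<open>p * q\<close> first, which is
    invisible modulo either divisor.\<close>
  have mods: "x mod (p * q) mod p = x mod p" "x mod (p * q) mod q = x mod q" for x
    by (simp_all add: mod_mod_cancel)
  have "?h \<in> ring_iso ?A ?B"
  proof (rule ring_iso_memI)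
    fix x assume "x \<in> carrier ?A"
    then show "?h x \<in> carrier ?B" using into by blast
  next
    fix x y
    show "?h (x \<otimes>\<^bsub>?A\<^esub> y) = ?h x \<otimes>\<^bsub>?B\<^esub> ?h y"
      by (cases x; cases y) (simp add: residue_ring_def mods mod_simps)
    show "?h (x \<oplus>\<^bsub>?A\<^esub> y) = ?h x \<oplus>\<^bsub>?B\<^esub> ?h y"
      by (cases x; cases y) (simp add: residue_ring_def mods mod_simps)
  next
    show "?h \<one>\<^bsub>?A\<^esub> = \<one>\<^bsub>?B\<^esub>"
      using p q by (simp add: residue_ring_def)
  qed (rule bij)
  then show ?thesis
    by (auto simp: is_ring_iso_def)
qed

lemma dual_numbers_mod_iso:
  assumes "n > 1"
  shows "dual_numbers_mod n \<simeq> dual_ring (residue_ring (int n))" and "cring (dual_numbers_mod n)"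
proof -
  interpret residues "int n" "residue_ring (int n)"
    by unfold_locales (use assms in auto)
  interpret UP: UP_cring "residue_ring (int n)" "UP (residue_ring (int n))"
    by (intro UP_cring.intro cring) simp
  show "dual_numbers_mod n \<simeq> dual_ring (residue_ring (int n))"
    using UP.quotient_dual_ring_iso by (simp add: dual_numbers_mod_def Let_def)
  show "cring (dual_numbers_mod n)"
    unfolding dual_numbers_mod_def Let_def
    by (intro ideal.quotient_is_cring UP.P.cgenideal_ideal UP.P.is_cring UP.monom_closed one_closed)
qed

section \<open>The cozero-divisor graph\<close>

text \<open>The componentwise order on levels mirrors inclusion of the generated ideals; this
  relation will serve as \<open>N\<close> for the blow-up.\<close>

definition incomparable :: "nat \<times> nat \<Rightarrow> nat \<times> nat \<Rightarrow> bool" where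
  "incomparable a b \<longleftrightarrow> \<not> (fst a \<le> fst b \<and> snd a \<le> snd b) \<and> \<not> (fst b \<le> fst a \<and> snd b \<le> snd a)"

text \<open>
  Levels 0, 1 and 2 stand for zero, nonzero nilpotent and unit; the order is that of the rows of
  \<open>class_matrix\<close>.
\<close>

definition class_list :: "(nat \<times> nat) list" where
  "class_list = [(0, 1), (1, 0), (1, 1), (0, 2), (2, 0), (1, 2), (2, 1)]"

text \<open>The two excluded pairs are the levels of zero and of the units, so the list consists of
  the levels that vertices can have.\<close>

lemma in_class_list_iff:
  "(i, j) \<in> set class_list \<longleftrightarrow> i \<le> 2 \<and> j \<le> 2 \<and> (i, j) \<noteq> (0, 0) \<and> (i, j) \<noteq> (2, 2)"
proof (cases "i \<le> 2 \<and> j \<le> 2")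
  case True
  then have "i = 0 \<or> i = 1 \<or> i = 2" "j = 0 \<or> j = 1 \<or> j = 2" by linarith+
  then show ?thesis
    by (elim disjE) (simp_all add: class_list_def)
qed (auto simp: class_list_def)

definition class_size :: "nat \<Rightarrow> nat \<Rightarrow> nat \<times> nat \<Rightarrow> nat" where
  "class_size p q a = level_count p (fst a) * level_count q (snd a)"

text \<open>Membership in a principal ideal is decided in each factor by comparing levels. Vertices,
  adjacency and class sizes can therefore all be read off the pair \<open>lev\<close>.\<close>

lemma dual_product_graph:
  fixes F :: "('a, 'm) ring_scheme" and G :: "('b, 'n) ring_scheme"
  assumes F: "field F" "finite (carrier F)" and G: "field G" "finite (carrier G)"
  defines "S \<equiv> RDirProd (dual_ring F) (dual_ring G)"
  defines "lev \<equiv> \<lambda>w. (dual_level F (fst w), dual_level G (snd w))"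
  shows "cozero_vertices S = {w \<in> carrier S. lev w \<in> set class_list}"
    and "u \<in> cozero_vertices S \<Longrightarrow> v \<in> cozero_vertices S \<Longrightarrow>
      cozero_adj S u v \<longleftrightarrow> incomparable (lev u) (lev v)"
    and "a \<in> set class_list \<Longrightarrow>
      card {w \<in> cozero_vertices S. lev w = a} = class_size (card (carrier F)) (card (carrier G)) a"
proof -
  interpret F: field F by fact
  interpret G: field G by fact
  interpret S: cring S
    unfolding S_def by (rule RDirProd_cring[OF F.dual_ring_cring G.dual_ring_cring])
  have PIdl: "u \<in> PIdl\<^bsub>S\<^esub> v \<longleftrightarrow> fst (lev u) \<le> fst (lev v) \<and> snd (lev u) \<le> snd (lev v)"
    if "u \<in> carrier S" "v \<in> carrier S" for u v
  proof -
    have "fst u \<in> carrier (dual_ring F)" "snd u \<in> carrier (dual_ring G)"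
      "fst v \<in> carrier (dual_ring F)" "snd v \<in> carrier (dual_ring G)"
      using that by (simp_all only: S_def RDirProd_simps mem_Times_iff)
    then show ?thesis
      using PIdl_RDirProd[of "dual_ring F" "dual_ring G" "fst v" "snd v"]
      by (simp only: S_def lev_def mem_Times_iff prod.collapse fst_conv snd_conv
          F.dual_ring_PIdl_iff G.dual_ring_PIdl_iff)
  qed
  have one: "lev \<one>\<^bsub>S\<^esub> = (2, 2)"
    by (simp add: S_def lev_def dual_level_def)
  have zero: "w = \<zero>\<^bsub>S\<^esub> \<longleftrightarrow> lev w = (0, 0)" for w
    by (cases w) (simp add: S_def lev_def dual_level_eq_0_iff del: dual_ring_simps)
  have le: "fst (lev w) \<le> 2" "snd (lev w) \<le> 2" for w
    by (simp_all add: lev_def dual_level_le)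
  have unit: "w \<in> Units S \<longleftrightarrow> lev w = (2, 2)" if "w \<in> carrier S" for w
    using that PIdl[OF S.one_closed that] le[of w]
    by (auto simp: S.Units_iff_one_in_PIdl one prod_eq_iff)
  have set_iff: "lev w \<in> set class_list \<longleftrightarrow> lev w \<noteq> (0, 0) \<and> lev w \<noteq> (2, 2)" for w
    using le[of w] in_class_list_iff[of "fst (lev w)" "snd (lev w)"] by simp
  show vertices: "cozero_vertices S = {w \<in> carrier S. lev w \<in> set class_list}"
  proof (rule Set.set_eqI)
    fix w
    show "w \<in> cozero_vertices S \<longleftrightarrow> w \<in> {w \<in> carrier S. lev w \<in> set class_list}"
      using unit[of w] zero[of w] set_iff[of w] unfolding cozero_vertices_def by blast
  qed
  show "cozero_adj S u v \<longleftrightarrow> incomparable (lev u) (lev v)"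
    if "u \<in> cozero_vertices S" "v \<in> cozero_vertices S"
    using that PIdl[of u v] PIdl[of v u] by (auto simp: vertices cozero_adj_def incomparable_def)
  show "card {w \<in> cozero_vertices S. lev w = a} = class_size (card (carrier F)) (card (carrier G)) a"
    if a: "a \<in> set class_list"
  proof -
    \<comment> \<open>Elements with levels in the list are automatically vertices, so each class is
      a full product of two level sets.\<close>
    have "{w \<in> cozero_vertices S. lev w = a} = {w \<in> carrier S. lev w = a}"
      using a by (auto simp: vertices)
    also have "\<dots> = {x \<in> carrier (dual_ring F). dual_level F x = fst a} \<times>
        {x \<in> carrier (dual_ring G). dual_level G x = snd a}"
      by (cases a) (auto simp: S_def lev_def simp del: dual_ring_simps)
    finally have "{w \<in> cozero_vertices S. lev w = a} = \<dots>" .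
    moreover have "fst a \<le> 2" "snd a \<le> 2"
      using a in_class_list_iff[of "fst a" "snd a"] by simp_all
    ultimately show ?thesis
      using F.card_dual_level[OF F(2)] G.card_dual_level[OF G(2)]
      by (simp add: card_cartesian_product class_size_def)
  qed
qed

lemma residue_ring_prime:
  assumes "prime p"
  shows "field (residue_ring (int p))" "finite (carrier (residue_ring (int p)))"
    and "card (carrier (residue_ring (int p))) = p"
proof -
  interpret residues_prime p "residue_ring (int p)"
    by unfold_locales (use assms in auto)
  show "field (residue_ring (int p))" by (rule is_field)
  show "finite (carrier (residue_ring (int p)))" by simp
  show "card (carrier (residue_ring (int p))) = p" by (simp add: res_carrier_eq)
qed

section \<open>Degrees, multiplicities and the matrix of the seven classes\<close>

definition class_degree :: "nat \<Rightarrow> nat \<Rightarrow> nat \<times> nat \<Rightarrow> nat" where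
  "class_degree p q a = (\<Sum>b\<in>set class_list. if incomparable a b then class_size p q b else 0)"

text \<open>Each value sums the sizes of the incomparable classes. For instance
  \<open>(0, 1)\<close> is incomparable to \<open>(1, 0)\<close> and \<open>(2, 0)\<close> only,
  which gives \<open>(p - 1) + p * (p - 1)\<close>.\<close>

lemma class_degrees:
  assumes "p > 0" "q > 0"
  shows "class_degree p q (0, 1) = p\<^sup>2 - 1"
    and "class_degree p q (1, 0) = q\<^sup>2 - 1"
    and "class_degree p q (1, 1) = q * (q - 1) + p * (p - 1)"
    and "class_degree p q (0, 2) = q * (p\<^sup>2 - 1)"
    and "class_degree p q (2, 0) = p * (q\<^sup>2 - 1)"
    and "class_degree p q (1, 2) = p * q * (p - 1)"
    and "class_degree p q (2, 1) = p * q * (q - 1)"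
proof -
  \<comment> \<open>Successors turn the truncated differences into polynomial identities in
    \<open>m\<close> and \<open>n\<close>.\<close>
  obtain m n where "p = Suc m" "q = Suc n"
    using assms gr0_implies_Suc by blast
  then show "class_degree p q (0, 1) = p\<^sup>2 - 1"
    "class_degree p q (1, 0) = q\<^sup>2 - 1"
    "class_degree p q (1, 1) = q * (q - 1) + p * (p - 1)"
    "class_degree p q (0, 2) = q * (p\<^sup>2 - 1)"
    "class_degree p q (2, 0) = p * (q\<^sup>2 - 1)"
    "class_degree p q (1, 2) = p * q * (p - 1)"
    "class_degree p q (2, 1) = p * q * (q - 1)"
    by (simp_all add: class_degree_def class_list_def incomparable_def class_size_def
        level_count_def power2_eq_square algebra_simps)
qed

lemma class_multiplicities:
  "class_size p q (0, 1) - 1 = q - 2"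
  "class_size p q (1, 0) - 1 = p - 2"
  "class_size p q (1, 1) - 1 = (p - 1) * (q - 1) - 1"
  "class_size p q (0, 2) - 1 = q * (q - 1) - 1"
  "class_size p q (2, 0) - 1 = p * (p - 1) - 1"
  "class_size p q (1, 2) - 1 = q * (p - 1) * (q - 1) - 1"
  "class_size p q (2, 1) - 1 = p * (p - 1) * (q - 1) - 1"
  by (simp_all add: class_size_def level_count_def mult_ac)

lemma sum_class_list:
  "(\<Sum>a\<in>set class_list. f a) =
    f (0, 1) + f (1, 0) + f (1, 1) + f (0, 2) + f (2, 0) + f (1, 2) + f (2, 1)"
  for f :: "nat \<times> nat \<Rightarrow> 'a :: comm_monoid_add"
  by (simp add: class_list_def add.assoc)

lemma class_matrix_eq:
  assumes "p > 0" "q > 0"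
  shows "mat (length class_list) (length class_list) (\<lambda>(i, j).
      (if i = j then of_nat (class_degree p q (class_list ! i)) else 0) -
      (if incomparable (class_list ! i) (class_list ! j)
       then of_nat (class_size p q (class_list ! j)) else 0))
    = class_matrix (of_nat p) (of_nat q)"
proof -
  \<comment> \<open>With successors the natural number \<open>p - 1\<close> becomes
    \<open>m\<close>, matching the complex difference in \<open>class_matrix\<close>; the 49 entries
    are then compared one by one.\<close>
  obtain m n where "p = Suc m" "q = Suc n"
    using assms gr0_implies_Suc by blast
  moreover have "{..<7} = {0, 1, 2, 3, 4, 5, 6 :: nat}" by auto
  ultimately have "\<forall>i\<in>{..<7}. \<forall>j\<in>{..<7}.
      (if i = j then of_nat (class_degree p q (class_list ! i)) else 0) -
      (if incomparable (class_list ! i) (class_list ! j)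
       then of_nat (class_size p q (class_list ! j)) else 0)
      = class_matrix (of_nat p) (of_nat q) $$ (i, j)"
    by (simp add: class_matrix_def class_list_def incomparable_def class_degree_def class_size_def
        level_count_def mat_of_rows_list_def power2_eq_square algebra_simps)
  then show ?thesis
    by (intro eq_matI) (auto simp: class_list_def class_matrix_def mat_of_rows_list_def)
qed

text \<open>Each class contributes its degree with multiplicity one less than its size. The first
  two blocks come from the classes \<open>(1, 2)\<close> and \<open>(2, 1)\<close>, the next five
  from \<open>(0, 1)\<close>, \<open>(1, 0)\<close>, \<open>(1, 1)\<close>, \<open>(0, 2)\<close>
  and \<open>(2, 0)\<close>, in this order.\<close>

theorem theorem3p6:
  fixes p q :: nat
  assumes "prime p" and "prime q" and "p \<noteq> q"
  shows "has_laplacian_spectrum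
      (cozero_vertices (dual_numbers_mod (p * q)))
      (cozero_adj (dual_numbers_mod (p * q)))
      (replicate_mset (q * (p - 1) * (q - 1) - 1) (of_nat (p * q * (p - 1)))
       + replicate_mset (p * (p - 1) * (q - 1) - 1) (of_nat (p * q * (q - 1)))
       + replicate_mset (q - 2) (of_nat (p^2 - 1))
       + replicate_mset (p - 2) (of_nat (q^2 - 1))
       + replicate_mset ((p - 1) * (q - 1) - 1) (of_nat (q * (q - 1) + p * (p - 1)))
       + replicate_mset (q * (q - 1) - 1) (of_nat (q * (p^2 - 1)))
       + replicate_mset (p * (p - 1) - 1) (of_nat (p * (q^2 - 1)))
       + eigenvalue_mset (class_matrix (of_nat p) (of_nat q)))"
    (is "has_laplacian_spectrum _ _ ?S")
proof -
  define R where "R = dual_numbers_mod (p * q)"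
  define F where "F = residue_ring (int p)"
  define G where "G = residue_ring (int q)"
  define S where "S = RDirProd (dual_ring F) (dual_ring G)"
  have gt1: "p > 1" "q > 1"
    using assms prime_gt_1_nat by auto
  have pq: "p * q > 1"
    using gt1 by (metis less_1_mult)
  have "coprime (int p) (int q)"
    using assms primes_coprime by auto
  then have "dual_ring (residue_ring (int p * int q)) \<simeq> S"
    unfolding S_def F_def G_def using gt1 by (intro dual_residue_ring_iso) auto
  then have "R \<simeq> S"
    using dual_numbers_mod_iso(1)[OF pq] ring_iso_trans by (auto simp: R_def)
  then obtain h where h: "h \<in> ring_iso R S"
    by (auto simp: is_ring_iso_def)
  have R: "cring R"
    unfolding R_def by (rule dual_numbers_mod_iso(2)[OF pq])
  note F = residue_ring_prime[OF assms(1), folded F_def]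
  note G = residue_ring_prime[OF assms(2), folded G_def]
  have S: "cring S"
    unfolding S_def
    using F(1) G(1) by (intro RDirProd_cring cring.dual_ring_cring fieldE(1))
  define lev where "lev w = (dual_level F (fst w), dual_level G (snd w))" for w
  note graph = dual_product_graph[OF F(1,2) G(1,2), folded S_def, folded lev_def, unfolded F(3) G(3)]
  have bij: "bij_betw h (cozero_vertices R) (cozero_vertices S)"
    by (rule iso_cozero_vertices[OF R S h])
  have in_S: "h u \<in> cozero_vertices S" if "u \<in> cozero_vertices R" for u
    using bij that by (auto simp: bij_betw_def)
  \<comment> \<open>The graph is studied on the product side: \<open>h\<close> preserves and
    reflects membership in principal ideals, hence adjacency.\<close>
  have adj: "cozero_adj R u v \<longleftrightarrow> incomparable (lev (h u)) (lev (h v))"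
    if u: "u \<in> cozero_vertices R" and v: "v \<in> cozero_vertices R" for u v
  proof -
    have "u \<in> carrier R" "v \<in> carrier R"
      using u v by (auto simp: cozero_vertices_def)
    moreover have "u = v \<longleftrightarrow> h u = h v"
      using bij u v by (auto simp: bij_betw_def inj_on_def)
    ultimately have "cozero_adj R u v \<longleftrightarrow> cozero_adj S (h u) (h v)"
      using u v in_S iso_PIdl[OF R h] by (simp add: cozero_adj_def)
    also have "\<dots> \<longleftrightarrow> incomparable (lev (h u)) (lev (h v))"
      by (rule graph(2)[OF in_S[OF u] in_S[OF v]])
    finally show ?thesis .
  qed
  have size: "card {v \<in> cozero_vertices R. lev (h v) = a} = class_size p q a"
    if "a \<in> set class_list" for a
  proof -
    have S_eq: "cozero_vertices S = h ` cozero_vertices R"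
      using bij by (simp add: bij_betw_def)
    have "h ` {v \<in> cozero_vertices R. lev (h v) = a} = {w \<in> cozero_vertices S. lev w = a}"
      unfolding S_eq by blast
    moreover have "inj_on h {v \<in> cozero_vertices R. lev (h v) = a}"
      using bij by (auto simp: bij_betw_def intro: inj_on_subset)
    ultimately have "card {v \<in> cozero_vertices R. lev (h v) = a} =
        card {w \<in> cozero_vertices S. lev w = a}"
      using card_image by fastforce
    then show ?thesis
      using graph(3)[OF that] by simp
  qed
  have "finite (cozero_vertices S)"
    unfolding cozero_vertices_def S_def using F(2) G(2) by simp
  then have fin: "finite (cozero_vertices R)"
    using bij_betw_finite[OF bij] by simp
  \<comment> \<open>All seven classes occur, as their sizes are positive for
    \<open>p, q > 1\<close>; the class function must be onto for the blow-up.\<close>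
  have onto: "(\<lambda>v. lev (h v)) ` cozero_vertices R = set class_list"
  proof
    show "(\<lambda>v. lev (h v)) ` cozero_vertices R \<subseteq> set class_list"
      using in_S graph(1) by auto
    show "set class_list \<subseteq> (\<lambda>v. lev (h v)) ` cozero_vertices R"
    proof
      fix a assume a: "a \<in> set class_list"
      have "class_size p q a > 0"
        using gt1 by (simp add: class_size_def level_count_def)
      then have "{v \<in> cozero_vertices R. lev (h v) = a} \<noteq> {}"
        using size[OF a] by (metis card.empty less_irrefl)
      then show "a \<in> (\<lambda>v. lev (h v)) ` cozero_vertices R"
        by auto
    qed
  qed
  note degrees = class_degrees[OF prime_gt_0_nat[OF assms(1)] prime_gt_0_nat[OF assms(2)]]
  have distinct: "distinct class_list"
    by (simp add: class_list_def)
  have "eigenvalue_mset (laplacian_matrix vs (cozero_adj R)) = ?S"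
    if vs: "distinct vs" "set vs = cozero_vertices R" for vs
  proof -
    have deg: "(\<Sum>b\<in>set class_list. if incomparable a b
        then card {v \<in> set vs. lev (h v) = b} else 0) = class_degree p q a" for a
      unfolding class_degree_def vs(2) by (intro sum.cong refl) (simp add: size)
    have mult: "(\<Sum>a\<in>set class_list. replicate_mset (card {v \<in> set vs. lev (h v) = a} - 1)
          (of_nat (class_degree p q a) :: complex)) =
        (\<Sum>a\<in>set class_list. replicate_mset (class_size p q a - 1) (of_nat (class_degree p q a)))"
      unfolding vs(2) by (intro sum.cong refl) (simp add: size)
    have mat: "mat (length class_list) (length class_list) (\<lambda>(i, j).
          (if i = j then of_nat (class_degree p q (class_list ! i)) else 0) -
          (if incomparable (class_list ! i) (class_list ! j)
           then of_nat (card {v \<in> set vs. lev (h v) = class_list ! j}) else 0))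
        = class_matrix (of_nat p) (of_nat q)"
      unfolding vs(2)
      using gt1 by (subst class_matrix_eq[symmetric]) (auto intro!: cong_mat simp: size)
    have "eigenvalue_mset (laplacian_matrix vs (cozero_adj R)) =
        (\<Sum>a\<in>set class_list. replicate_mset (class_size p q a - 1) (of_nat (class_degree p q a))) +
        eigenvalue_mset (class_matrix (of_nat p) (of_nat q))"
      \<comment> \<open>The class of a vertex is the pair of levels of its image under
        \<open>h\<close>.\<close>
      using eigenvalue_mset_laplacian_classes[OF vs(1) distinct,
          where c = "\<lambda>v. lev (h v)" and N = incomparable and adj = "cozero_adj R"]
      unfolding deg mult mat by (simp add: vs(2) onto adj)
    also have "(\<Sum>a\<in>set class_list. replicate_mset (class_size p q a - 1)
        (of_nat (class_degree p q a) :: complex)) + eigenvalue_mset (class_matrix (of_nat p) (of_nat q)) = ?S"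
      unfolding sum_class_list by (simp only: degrees class_multiplicities add_ac)
    finally show ?thesis .
  qed
  then show ?thesis
    using fin unfolding has_laplacian_spectrum_def R_def by blast
qed

end
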